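(* Let $G$ and $G'$ be finite abelian groups of the same order with normalized character tables $\mathcal{C}$ and $\mathcal{C}'$ respectively. Fix isomorphisms $\phi:\widehat{G}\to G$ and $\phi':\widehat{G'}\to G'$, and let $\Phi\in\mathbb{C}^{G\times\widehat{G}}$ and $\Phi'\in\mathbb{C}^{G'\times\widehat{G'}}$ be the permutation matrices encoding these isomorphisms. Then for every bijection $\pi:G'\to G$ and $\hat{\pi}=\phi^{-1}\circ\pi\circ\phi':\widehat{G'}\to\widehat{G}$, we have $$Q^{\hat{\pi}}=\mathcal{C}^\dagger\Phi^\dagger D^\pi\Phi'\mathcal{C}'.$$
   Context: $\widehat{G}$ denotes the group of (complex, degree one) characters of $G$. The normalized character table $\mathcal{C}$ of $G$ is the matrix with rows indexed by $\widehat{G}$, columns indexed by $G$, and $(\chi,a)$-entry $\frac{1}{\sqrt{|G|}}\chi(a)$. For a bijection $\tau:B\to A$ between finite sets, the permutation matrix encoding it is the $A\times B$ matrix $P^\tau$ with $P^\tau_{x,y}=1$ if $x=\tau(y)$ and $0$ otherwise; thus $\Phi=P^{\phi}$ and $\Phi'=P^{\phi'}$. For a bijection $\hat{\pi}:\widehat{G'}\to\widehat{G}$, set $U^{\hat{\pi}}=\mathcal{C}^\dagger P^{\hat{\pi}}\mathcal{C}'\in\mathbb{C}^{G\times G'}$ and $Q^{\hat{\pi}}=U^{\hat{\pi}}\circ\overline{U^{\hat{\pi}}}$, where $\circ$ between matrices is the entrywise product (so $Q^{\hat\pi}_{a,b}=|U^{\hat\pi}_{a,b}|^2$). For a bijection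 $\pi:G'\to G$, $D^\pi$ is the $G\times G'$ matrix defined as follows. Let $p_\pi(b,d|a,c)=1$ if $b=\pi(a)$ and $d=\pi(c)$, and $0$ otherwise ($b,d\in G$, $a,c\in G'$). For a group $K$ let $p_K(b,d|a,c)=\frac{1}{|K|}$ if $b^{-1}d=a^{-1}c$ and $0$ otherwise ($a,b,c,d\in K$). The composition is $(p_1\circ p_2)(b,d|a,c)=\sum_{x,y}p_1(b,d|x,y)\,p_2(x,y|a,c)$. Put $\hat p_\pi=p_G\circ p_\pi\circ p_{G'}$; its value at $(b,d|a,c)$ depends only on $b^{-1}d\in G$ and $a^{-1}c\in G'$, and $D^\pi_{x,y}=|G|\,\hat p_\pi(b,d|a,c)$ for any $b,d\in G$, $a,c\in G'$ with $b^{-1}d=x$, $a^{-1}c=y$. *)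

theory Defs
  imports Complex_Main "HOL-Algebra.Coset"
begin

section \<open>Matrices indexed by sets\<close>

text \<open>An $I \times J$ matrix is a function whose values at indices outside $I \times J$ are
  irrelevant. The index set being summed over is therefore an argument of the matrix product,
  and two $I \times J$ matrices are compared entrywise on $I \times J$ only.\<close>

type_synonym ('i, 'j) cmat = "'i \<Rightarrow> 'j \<Rightarrow> complex"

definition mat_mult :: "'j set \<Rightarrow> ('i, 'j) cmat \<Rightarrow> ('j, 'k) cmat \<Rightarrow> ('i, 'k) cmat" where
  "mat_mult J M N = (\<lambda>i k. \<Sum>j\<in>J. M i j * N j k)"

definition mat_adjoint :: "('i, 'j) cmat \<Rightarrow> ('j, 'i) cmat" where
  "mat_adjoint M = (\<lambda>j i. cnj (M i j))"

definition mat_conj :: "('i, 'j) cmat \<Rightarrow> ('i, 'j) cmat" where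
  "mat_conj M = (\<lambda>i j. cnj (M i j))"

definition entrywise_mult :: "('i, 'j) cmat \<Rightarrow> ('i, 'j) cmat \<Rightarrow> ('i, 'j) cmat" where
  "entrywise_mult M N = (\<lambda>i j. M i j * N i j)"

definition mat_eq_on :: "'i set \<Rightarrow> 'j set \<Rightarrow> ('i, 'j) cmat \<Rightarrow> ('i, 'j) cmat \<Rightarrow> bool" where
  "mat_eq_on I J M N \<longleftrightarrow> (\<forall>i\<in>I. \<forall>j\<in>J. M i j = N i j)"

definition perm_matrix :: "('j \<Rightarrow> 'i) \<Rightarrow> ('i, 'j) cmat" where
  "perm_matrix \<tau> = (\<lambda>x y. if x = \<tau> y then 1 else 0)"

section \<open>Characters\<close>

definition complex_units :: "complex monoid" where
  "complex_units = \<lparr>carrier = UNIV - {0}, mult = (*), one = 1\<rparr>"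

text \<open>Characters are required to be extensional so that each homomorphism
  $G \to \mathbb{C}^\times$ is represented by exactly one HOL function.\<close>

definition character_group :: "('a, 'm) monoid_scheme \<Rightarrow> ('a \<Rightarrow> complex) monoid" where
  "character_group G =
     \<lparr>carrier = hom G complex_units \<inter> extensional (carrier G),
      mult = (\<lambda>\<chi> \<psi>. \<lambda>x\<in>carrier G. \<chi> x * \<psi> x),
      one = (\<lambda>x\<in>carrier G. 1)\<rparr>"

definition char_table :: "('a, 'm) monoid_scheme \<Rightarrow> ('a \<Rightarrow> complex, 'a) cmat" where
  "char_table G = (\<lambda>\<chi> a. 1 / of_real (sqrt (real (order G))) * \<chi> a)"

definition U_matrix ::
  "('a, 'm) monoid_scheme \<Rightarrow> ('b, 'n) monoid_scheme \<Rightarrow> (('b \<Rightarrow> complex) \<Rightarrow> ('a \<Rightarrow> complex)) \<Rightarrow> ('a, 'b) cmat"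
  where
  "U_matrix G G' \<pi>h =
     mat_mult (carrier (character_group G)) (mat_adjoint (char_table G))
       (mat_mult (carrier (character_group G')) (perm_matrix \<pi>h) (char_table G'))"

definition Q_matrix ::
  "('a, 'm) monoid_scheme \<Rightarrow> ('b, 'n) monoid_scheme \<Rightarrow> (('b \<Rightarrow> complex) \<Rightarrow> ('a \<Rightarrow> complex)) \<Rightarrow> ('a, 'b) cmat"
  where
  "Q_matrix G G' \<pi>h = entrywise_mult (U_matrix G G' \<pi>h) (mat_conj (U_matrix G G' \<pi>h))"

section \<open>Correlations\<close>

text \<open>\<open>p b d a c\<close> stands for $p(b, d \mid a, c)$: outputs \<open>b\<close>, \<open>d\<close> on inputs \<open>a\<close>, \<open>c\<close>.\<close>

type_synonym ('o, 'i) correlation = "'o \<Rightarrow> 'o \<Rightarrow> 'i \<Rightarrow> 'i \<Rightarrow> real"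

definition bij_corr :: "('b \<Rightarrow> 'a) \<Rightarrow> ('a, 'b) correlation" where
  "bij_corr \<pi> = (\<lambda>b d a c. if b = \<pi> a \<and> d = \<pi> c then 1 else 0)"

definition group_corr :: "('a, 'm) monoid_scheme \<Rightarrow> ('a, 'a) correlation" where
  "group_corr K = (\<lambda>b d a c.
     if inv\<^bsub>K\<^esub> b \<otimes>\<^bsub>K\<^esub> d = inv\<^bsub>K\<^esub> a \<otimes>\<^bsub>K\<^esub> c then 1 / real (order K) else 0)"

text \<open>The set argument is where the intermediate outputs range.\<close>

definition corr_comp ::
  "'x set \<Rightarrow> ('o, 'x) correlation \<Rightarrow> ('x, 'i) correlation \<Rightarrow> ('o, 'i) correlation" where
  "corr_comp X p\<^sub>1 p\<^sub>2 = (\<lambda>b d a c. \<Sum>x\<in>X. \<Sum>y\<in>X. p\<^sub>1 b d x y * p\<^sub>2 x y a c)"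

definition averaged_corr ::
  "('a, 'm) monoid_scheme \<Rightarrow> ('b, 'n) monoid_scheme \<Rightarrow> ('b \<Rightarrow> 'a) \<Rightarrow> ('a, 'b) correlation" where
  "averaged_corr G G' \<pi> =
     corr_comp (carrier G) (group_corr G)
       (corr_comp (carrier G') (bij_corr \<pi>) (group_corr G'))"

text \<open>The description operator expresses that the entry is the common value over all
  representatives; the lemma \<open>D_matrix_eq\<close> below shows that this common value exists.\<close>

definition D_matrix ::
  "('a, 'm) monoid_scheme \<Rightarrow> ('b, 'n) monoid_scheme \<Rightarrow> ('b \<Rightarrow> 'a) \<Rightarrow> ('a, 'b) cmat" where
  "D_matrix G G' \<pi> = (\<lambda>x y. THE z. \<forall>b\<in>carrier G. \<forall>d\<in>carrier G. \<forall>a\<in>carrier G'. \<forall>c\<in>carrier G'.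
     inv\<^bsub>G\<^esub> b \<otimes>\<^bsub>G\<^esub> d = x \<longrightarrow> inv\<^bsub>G'\<^esub> a \<otimes>\<^bsub>G'\<^esub> c = y \<longrightarrow>
     z = complex_of_real (real (order G) * averaged_corr G G' \<pi> b d a c))"

lemma averaged_corr_cong:
  assumes "inv\<^bsub>G\<^esub> b \<otimes>\<^bsub>G\<^esub> d = inv\<^bsub>G\<^esub> b' \<otimes>\<^bsub>G\<^esub> d'"
    and "inv\<^bsub>G'\<^esub> a \<otimes>\<^bsub>G'\<^esub> c = inv\<^bsub>G'\<^esub> a' \<otimes>\<^bsub>G'\<^esub> c'"
  shows "averaged_corr G G' \<pi> b d a c = averaged_corr G G' \<pi> b' d' a' c'"
  using assms by (simp add: averaged_corr_def corr_comp_def group_corr_def)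

lemma D_matrix_eq:
  assumes "b \<in> carrier G" "d \<in> carrier G" "a \<in> carrier G'" "c \<in> carrier G'"
  shows "D_matrix G G' \<pi> (inv\<^bsub>G\<^esub> b \<otimes>\<^bsub>G\<^esub> d) (inv\<^bsub>G'\<^esub> a \<otimes>\<^bsub>G'\<^esub> c) =
    complex_of_real (real (order G) * averaged_corr G G' \<pi> b d a c)"
  unfolding D_matrix_def
proof (rule the_equality, goal_cases)
  case 1
  show ?case by (metis averaged_corr_cong)
next
  case (2 z)
  then show ?case using assms by blast
qed

end

theory Submission
  imports Defs "HOL-Algebra.Multiplicative_Group"
begin

text \<open>Parametrise the characters by group elements through the isomorphisms, writing
  $\chi_x = \phi^{-1}(x)$ and $\psi_y = \phi'^{-1}(y)$. Then
  $U_{a,b} = \frac1n \sum_{t} \overline{\chi_{\pi(t)}(a)}\, \psi_t(b)$, and expanding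
  $U_{a,b} \overline{U_{a,b}}$ as a double sum over $s, t \in G'$, multiplicativity of
  $x \mapsto \chi_x$ and $|\chi_x(a)| = 1$ merge the factors into
  $\overline{\chi_{\pi(s)^{-1}\pi(t)}(a)}\, \psi_{s^{-1}t}(b)$. Grouping the pairs $(s,t)$ by
  $x = \pi(s)^{-1}\pi(t)$ and $y = s^{-1}t$ counts exactly the entry $n D^\pi_{x,y}$.\<close>

section \<open>Characters of a finite group\<close>

lemma char_mult:
  assumes "\<chi> \<in> carrier (character_group G)" "a \<in> carrier G" "b \<in> carrier G"
  shows "\<chi> (a \<otimes>\<^bsub>G\<^esub> b) = \<chi> a * \<chi> b"
  using assms by (auto simp: character_group_def complex_units_def hom_def)

lemma char_nonzero:
  assumes "\<chi> \<in> carrier (character_group G)" "a \<in> carrier G"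
  shows "\<chi> a \<noteq> 0"
  using assms by (auto simp: character_group_def complex_units_def hom_def)

lemma char_one:
  assumes "group G" "\<chi> \<in> carrier (character_group G)"
  shows "\<chi> \<one>\<^bsub>G\<^esub> = 1"
proof -
  interpret group G by fact
  have "\<chi> \<one>\<^bsub>G\<^esub> * \<chi> \<one>\<^bsub>G\<^esub> = \<chi> \<one>\<^bsub>G\<^esub>"
    using char_mult[OF assms(2), of "\<one>\<^bsub>G\<^esub>" "\<one>\<^bsub>G\<^esub>"] by simp
  then show ?thesis using char_nonzero[OF assms(2) one_closed] by simp
qed

lemma char_pow:
  assumes "group G" "\<chi> \<in> carrier (character_group G)" "a \<in> carrier G"
  shows "\<chi> (a [^]\<^bsub>G\<^esub> (k::nat)) = \<chi> a ^ k"
proof -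
  interpret group G by fact
  show ?thesis
    using assms by (induction k) (simp_all add: char_one char_mult)
qed

text \<open>By Lagrange, \<open>a\<close> to the power \<open>order G\<close> is the identity, so
  \<open>\<chi> a\<close> is a root of unity; a nonnegative real with a positive power equal to 1 is
  itself 1.\<close>

lemma norm_char:
  assumes "group G" "finite (carrier G)" "\<chi> \<in> carrier (character_group G)" "a \<in> carrier G"
  shows "norm (\<chi> a) = 1"
proof -
  interpret group G by fact
  have "\<chi> a ^ order G = 1"
    using char_pow[OF assms(1,3,4), of "order G"] assms
    by (simp add: pow_order_eq_1 char_one)
  then have "norm (\<chi> a) ^ order G = 1"
    by (metis norm_one norm_power)
  moreover have "order G > 0"
    using assms(2) order_gt_0_iff_finite by blast
  ultimately show ?thesis
    using power_eq_iff_eq_base[of "order G" "norm (\<chi> a)" 1] by simp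
qed

text \<open>\<open>character_group G\<close> is never shown to be a group. Closure is what lets
  \<open>inv_into\<close> cancel an isomorphism on a product of characters.\<close>

lemma char_group_mult_closed:
  assumes "group G" "\<chi> \<in> carrier (character_group G)" "\<psi> \<in> carrier (character_group G)"
  shows "\<chi> \<otimes>\<^bsub>character_group G\<^esub> \<psi> \<in> carrier (character_group G)"
proof -
  interpret group G by fact
  show ?thesis
    using assms(2,3) by (auto simp: character_group_def complex_units_def hom_def Pi_iff)
qed

text \<open>Multiplying the character of \<open>x\<close> by that of the quotient gives the
  character of \<open>y\<close>, because the isomorphism sends this product to \<open>y\<close>.
  After evaluation at \<open>a\<close>, dividing by \<open>f x a\<close> is conjugation, since that
  value has modulus 1. No inverse in the character group is formed.\<close>

lemma inv_iso_char_group_inv_mult: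
  assumes "group G" "finite (carrier G)" "\<phi> \<in> iso (character_group G) G"
    and "x \<in> carrier G" "y \<in> carrier G" "a \<in> carrier G"
  defines "f \<equiv> inv_into (carrier (character_group G)) \<phi>"
  shows "f (inv\<^bsub>G\<^esub> x \<otimes>\<^bsub>G\<^esub> y) a = cnj (f x a) * f y a"
proof -
  interpret group G by fact
  have bij: "bij_betw \<phi> (carrier (character_group G)) (carrier G)"
    and hom: "\<phi> \<in> hom (character_group G) G"
    using assms(3) by (auto simp: iso_def)
  have f_in: "f z \<in> carrier (character_group G)" if "z \<in> carrier G" for z
    unfolding f_def using bij that by (metis bij_betw_imp_surj_on inv_into_into)
  have phi_f: "\<phi> (f z) = z" if "z \<in> carrier G" for z
    unfolding f_def using bij that by (metis bij_betw_inv_into_right)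
  let ?d = "inv\<^bsub>G\<^esub> x \<otimes>\<^bsub>G\<^esub> y"
  have d: "?d \<in> carrier G" using assms by simp
  have "\<phi> (f x \<otimes>\<^bsub>character_group G\<^esub> f ?d) = x \<otimes>\<^bsub>G\<^esub> ?d"
    using hom_mult[OF hom f_in f_in] phi_f d assms by simp
  also have "\<dots> = y"
    using assms by (simp add: m_assoc[symmetric])
  finally have "f x \<otimes>\<^bsub>character_group G\<^esub> f ?d = f y"
    using bij_betw_inv_into_left[OF bij char_group_mult_closed[OF assms(1) f_in[OF assms(4)] f_in[OF d]]]
    by (simp add: f_def)
  then have "f x a * f ?d a = f y a"
    using assms(6) by (auto simp: character_group_def dest: fun_cong[of _ _ a])
  then have "cnj (f x a) * f y a = (f x a * cnj (f x a)) * f ?d a"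
    by (simp add: ac_simps flip: \<open>f x a * f ?d a = f y a\<close>)
  also have "\<dots> = f ?d a"
    using norm_char[OF assms(1,2) f_in[OF assms(4)] assms(6)]
    by (simp flip: complex_norm_square)
  finally show ?thesis ..
qed

section \<open>Correlations and the entries of \<open>D_matrix\<close>\<close>

text \<open>A bijection correlation is deterministic: \<open>s\<close> and \<open>t\<close> force
  the intermediate outputs, so the sums over \<open>X\<close> collapse.\<close>

lemma corr_comp_bij_corr:
  assumes "finite X" "finite Y" "\<pi> ` Y \<subseteq> X"
  shows "corr_comp X p (corr_comp Y (bij_corr \<pi>) q) b d a c =
    (\<Sum>s\<in>Y. \<Sum>t\<in>Y. p b d (\<pi> s) (\<pi> t) * q s t a c)"
proof -
  \<comment> \<open>The two conditions become one equation between pairs, so that after swapping the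
    sums a single delta removes the sum over \<open>X \<times> X\<close>.\<close>
  have "corr_comp X p (corr_comp Y (bij_corr \<pi>) q) b d a c =
      (\<Sum>(x, y)\<in>X \<times> X. \<Sum>(s, t)\<in>Y \<times> Y.
        if (x, y) = (\<pi> s, \<pi> t) then p b d x y * q s t a c else 0)"
    unfolding corr_comp_def bij_corr_def sum_distrib_left sum.cartesian_product[symmetric]
    by (intro sum.cong refl) auto
  also have "\<dots> = (\<Sum>(s, t)\<in>Y \<times> Y. \<Sum>(x, y)\<in>X \<times> X.
        if (x, y) = (\<pi> s, \<pi> t) then p b d x y * q s t a c else 0)"
    unfolding split_def by (rule sum.swap)
  also have "\<dots> = (\<Sum>(s, t)\<in>Y \<times> Y. p b d (\<pi> s) (\<pi> t) * q s t a c)"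
  proof (intro sum.cong refl, clarify)
    fix s t assume "s \<in> Y" "t \<in> Y"
    then have "(\<pi> s, \<pi> t) \<in> X \<times> X" using assms(3) by auto
    moreover have "(\<Sum>(x, y)\<in>X \<times> X. if (x, y) = (\<pi> s, \<pi> t) then p b d x y * q s t a c else 0) =
      (\<Sum>z\<in>X \<times> X. if z = (\<pi> s, \<pi> t) then p b d (\<pi> s) (\<pi> t) * q s t a c else 0)"
      by (intro sum.cong) (auto split: if_splits)
    ultimately show "(\<Sum>(x, y)\<in>X \<times> X. if (x, y) = (\<pi> s, \<pi> t) then p b d x y * q s t a c else 0) =
      p b d (\<pi> s) (\<pi> t) * q s t a c"
      using assms(1) by simp
  qed
  finally show ?thesis by (simp add: sum.cartesian_product)
qed

text \<open>The two group correlations contribute \<open>1 / order G\<close> and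
  \<open>1 / order G'\<close>, which agree; the prefactor \<open>order G\<close> in
  \<open>D_matrix\<close> cancels one of them.\<close>

lemma D_matrix_eq_sum:
  assumes "group G" "finite (carrier G)" "group G'" "finite (carrier G')"
    and "order G = order G'" "\<pi> ` carrier G' \<subseteq> carrier G"
    and "x \<in> carrier G" "y \<in> carrier G'"
  shows "D_matrix G G' \<pi> x y = 1 / of_nat (order G) * (\<Sum>s\<in>carrier G'. \<Sum>t\<in>carrier G'.
    if x = inv\<^bsub>G\<^esub> \<pi> s \<otimes>\<^bsub>G\<^esub> \<pi> t \<and> y = inv\<^bsub>G'\<^esub> s \<otimes>\<^bsub>G'\<^esub> t then 1 else 0)"
proof -
  interpret G: group G by fact
  interpret G': group G' by fact
  have n: "order G \<noteq> 0" using assms(2) G.order_gt_0_iff_finite by simp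
  \<comment> \<open>The representatives chosen for \<open>x\<close> and \<open>y\<close> are the
    pairs starting at the identity.\<close>
  have "D_matrix G G' \<pi> x y =
      complex_of_real (real (order G) * averaged_corr G G' \<pi> \<one>\<^bsub>G\<^esub> x \<one>\<^bsub>G'\<^esub> y)"
    using D_matrix_eq[of "\<one>\<^bsub>G\<^esub>" G x "\<one>\<^bsub>G'\<^esub>" G' y \<pi>] assms by simp
  also have "averaged_corr G G' \<pi> \<one>\<^bsub>G\<^esub> x \<one>\<^bsub>G'\<^esub> y =
    (\<Sum>s\<in>carrier G'. \<Sum>t\<in>carrier G'.
      (if x = inv\<^bsub>G\<^esub> \<pi> s \<otimes>\<^bsub>G\<^esub> \<pi> t \<and> y = inv\<^bsub>G'\<^esub> s \<otimes>\<^bsub>G'\<^esub> t then 1 else 0) * (1 / real (order G))\<^sup>2)"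
    unfolding averaged_corr_def corr_comp_bij_corr[OF assms(2,4,6)]
    using assms by (intro sum.cong refl) (auto simp: group_corr_def power2_eq_square)
  also have "\<dots> = (\<Sum>s\<in>carrier G'. \<Sum>t\<in>carrier G'.
      if x = inv\<^bsub>G\<^esub> \<pi> s \<otimes>\<^bsub>G\<^esub> \<pi> t \<and> y = inv\<^bsub>G'\<^esub> s \<otimes>\<^bsub>G'\<^esub> t then 1 else 0) * (1 / real (order G))\<^sup>2"
    by (simp only: sum_distrib_right)
  finally show ?thesis
    using n by (simp add: power2_eq_square if_distrib[of complex_of_real] cong: if_cong)
qed

text \<open>Double counting: the pairs \<open>(s, t)\<close> are grouped by their two quotients,
  each pair lying in exactly one fibre. The weight \<open>h\<close> will be a product of character
  values.\<close>

lemma sum_D_matrix: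
  assumes "group G" "finite (carrier G)" "group G'" "finite (carrier G')"
    and "order G = order G'" "\<pi> ` carrier G' \<subseteq> carrier G"
  shows "(\<Sum>x\<in>carrier G. \<Sum>y\<in>carrier G'. D_matrix G G' \<pi> x y * h x y) =
    1 / of_nat (order G) * (\<Sum>s\<in>carrier G'. \<Sum>t\<in>carrier G'.
      h (inv\<^bsub>G\<^esub> \<pi> s \<otimes>\<^bsub>G\<^esub> \<pi> t) (inv\<^bsub>G'\<^esub> s \<otimes>\<^bsub>G'\<^esub> t))"
proof -
  interpret G: group G by fact
  interpret G': group G' by fact
  define w where "w s t = (inv\<^bsub>G\<^esub> \<pi> s \<otimes>\<^bsub>G\<^esub> \<pi> t, inv\<^bsub>G'\<^esub> s \<otimes>\<^bsub>G'\<^esub> t)" for s t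
  let ?P = "carrier G \<times> carrier G'" and ?R = "carrier G' \<times> carrier G'"
  have "(\<Sum>x\<in>carrier G. \<Sum>y\<in>carrier G'. D_matrix G G' \<pi> x y * h x y) =
      (\<Sum>z\<in>?P. D_matrix G G' \<pi> (fst z) (snd z) * h (fst z) (snd z))"
    by (simp add: sum.cartesian_product split_def)
  also have "\<dots> = (\<Sum>z\<in>?P. \<Sum>r\<in>?R. 1 / of_nat (order G) *
      (if z = w (fst r) (snd r) then h (fst z) (snd z) else 0))"
  proof (intro sum.cong refl)
    fix z assume "z \<in> ?P"
    then have "D_matrix G G' \<pi> (fst z) (snd z) =
        1 / of_nat (order G) * (\<Sum>r\<in>?R. if z = w (fst r) (snd r) then 1 else 0)"
      by (subst D_matrix_eq_sum[OF assms])
        (auto simp: w_def sum.cartesian_product split_def prod_eq_iff intro!: sum.cong)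
    then have "D_matrix G G' \<pi> (fst z) (snd z) * h (fst z) (snd z) =
        1 / of_nat (order G) * ((\<Sum>r\<in>?R. if z = w (fst r) (snd r) then 1 else 0) * h (fst z) (snd z))"
      by (simp only: mult.assoc)
    also have "\<dots> = (\<Sum>r\<in>?R. 1 / of_nat (order G) *
        (if z = w (fst r) (snd r) then h (fst z) (snd z) else 0))"
      unfolding sum_distrib_left sum_distrib_right by (intro sum.cong refl) auto
    finally show "D_matrix G G' \<pi> (fst z) (snd z) * h (fst z) (snd z) = \<dots>" .
  qed
  \<comment> \<open>With \<open>r\<close> outermost, \<open>z = w (fst r) (snd r)\<close> is the
    only contributing term.\<close>
  also have "\<dots> = (\<Sum>r\<in>?R. \<Sum>z\<in>?P. 1 / of_nat (order G) *
      (if z = w (fst r) (snd r) then h (fst z) (snd z) else 0))"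
    by (rule sum.swap)
  also have "\<dots> = (\<Sum>r\<in>?R. 1 / of_nat (order G) *
      h (fst (w (fst r) (snd r))) (snd (w (fst r) (snd r))))"
  proof (intro sum.cong refl)
    fix r assume "r \<in> ?R"
    then have "w (fst r) (snd r) \<in> ?P"
      using assms(6) by (auto simp: w_def image_subset_iff)
    moreover have "(\<Sum>z\<in>?P. 1 / of_nat (order G) * (if z = w (fst r) (snd r) then h (fst z) (snd z) else 0)) =
      (\<Sum>z\<in>?P. if z = w (fst r) (snd r)
        then 1 / of_nat (order G) * h (fst (w (fst r) (snd r))) (snd (w (fst r) (snd r))) else 0)"
      by (intro sum.cong) auto
    ultimately show "(\<Sum>z\<in>?P. 1 / of_nat (order G) * (if z = w (fst r) (snd r) then h (fst z) (snd z) else 0)) =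
      1 / of_nat (order G) * h (fst (w (fst r) (snd r))) (snd (w (fst r) (snd r)))"
      using assms(2,4) by simp
  qed
  finally show ?thesis
    by (simp add: w_def sum.cartesian_product split_def sum_distrib_left)
qed

section \<open>Products with permutation matrices\<close>

text \<open>Injectivity leaves column \<open>j\<close> as the only nonzero one in row
  \<open>\<tau> j\<close>. Writing the row index as \<open>\<tau> j\<close> avoids inverting
  \<open>\<tau>\<close>. Applied below to both \<open>\<pi>h\<close> and
  \<open>\<phi>'\<close>.\<close>

lemma mat_mult_perm_matrix:
  assumes "finite J" "inj_on \<tau> J" "j \<in> J"
  shows "mat_mult J (perm_matrix \<tau>) M (\<tau> j) k = M j k"
proof -
  have "mat_mult J (perm_matrix \<tau>) M (\<tau> j) k = (\<Sum>i\<in>J. if i = j then M i k else 0)"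
    unfolding mat_mult_def perm_matrix_def using assms(2,3)
    by (intro sum.cong refl) (auto dest: inj_onD)
  then show ?thesis using assms(1,3) by simp
qed

lemma mat_mult_adjoint_perm_matrix:
  assumes "finite I" "\<tau> j \<in> I"
  shows "mat_mult I (mat_adjoint (perm_matrix \<tau>)) M j k = M (\<tau> j) k"
proof -
  have "mat_mult I (mat_adjoint (perm_matrix \<tau>)) M j k = (\<Sum>i\<in>I. if i = \<tau> j then M i k else 0)"
    unfolding mat_mult_def mat_adjoint_def perm_matrix_def
    by (intro sum.cong refl) auto
  then show ?thesis using assms by simp
qed

section \<open>Entrywise comparison of the two sides\<close>

theorem theorem9p4:
  fixes G :: "('a, 'm) monoid_scheme" and G' :: "('b, 'n) monoid_scheme"
    and \<phi> :: "('a \<Rightarrow> complex) \<Rightarrow> 'a" and \<phi>' :: "('b \<Rightarrow> complex) \<Rightarrow> 'b"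
    and \<pi> :: "'b \<Rightarrow> 'a" and \<pi>h :: "('b \<Rightarrow> complex) \<Rightarrow> ('a \<Rightarrow> complex)"
  assumes "comm_group G" and "finite (carrier G)"
    and "comm_group G'" and "finite (carrier G')"
    and "order G = order G'"
    and "\<phi> \<in> iso (character_group G) G"
    and "\<phi>' \<in> iso (character_group G') G'"
    and "bij_betw \<pi> (carrier G') (carrier G)"
    and "\<pi>h = inv_into (carrier (character_group G)) \<phi> \<circ> \<pi> \<circ> \<phi>'"
  shows "mat_eq_on (carrier G) (carrier G')
    (Q_matrix G G' \<pi>h)
    (mat_mult (carrier (character_group G)) (mat_adjoint (char_table G))
      (mat_mult (carrier G) (mat_adjoint (perm_matrix \<phi>))
        (mat_mult (carrier G') (D_matrix G G' \<pi>)
          (mat_mult (carrier (character_group G')) (perm_matrix \<phi>') (char_table G')))))"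
proof -
  interpret G: comm_group G by fact
  interpret G': comm_group G' by fact
  let ?X = "carrier (character_group G)" and ?X' = "carrier (character_group G')"
  define n where "n = order G"
  define f where "f = inv_into ?X \<phi>"
  define f' where "f' = inv_into ?X' \<phi>'"
  have bij: "bij_betw \<phi> ?X (carrier G)" and bij': "bij_betw \<phi>' ?X' (carrier G')"
    using assms(6,7) by (auto simp: iso_def)
  have bf: "bij_betw f (carrier G) ?X" and bf': "bij_betw f' (carrier G') ?X'"
    unfolding f_def f'_def using bij bij' by (auto intro: bij_betw_inv_into)
  \<comment> \<open>This bijection indexes the characters of \<open>G\<close> by \<open>G'\<close>,
    matching the row \<open>f (\<pi> t)\<close> of \<open>perm_matrix \<pi>h\<close> with its column
    \<open>f' t\<close>.\<close>
  have bfp: "bij_betw (f \<circ> \<pi>) (carrier G') ?X"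
    using bij_betw_trans[OF assms(8) bf] .
  have fin: "finite ?X" "finite ?X'"
    using bij_betw_finite[OF bij] bij_betw_finite[OF bij'] assms(2,4) by auto
  have pf: "\<phi> (f x) = x" if "x \<in> carrier G" for x
    unfolding f_def using bij that by (rule bij_betw_inv_into_right)
  have pf': "\<phi>' (f' x) = x" if "x \<in> carrier G'" for x
    unfolding f'_def using bij' that by (rule bij_betw_inv_into_right)
  have p_in: "\<pi> t \<in> carrier G" if "t \<in> carrier G'" for t
    using assms(8) that by (rule bij_betwE[THEN bspec])
  have p_sub: "\<pi> ` carrier G' \<subseteq> carrier G"
    using p_in by auto
  have ph: "\<pi>h (f' t) = f (\<pi> t)" if "t \<in> carrier G'" for t
    using that by (simp add: assms(9) pf' f_def)
  have inj_h: "inj_on \<pi>h ?X'"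
    using bij_betw_trans[OF bij' bfp] by (simp add: assms(9) f_def comp_assoc bij_betw_def)
  define c :: complex where "c = 1 / of_real (sqrt (real n))"
  have cnj_c: "cnj c = c" by (simp add: c_def)
  have cc: "c * c = 1 / of_nat n"
    by (simp add: c_def flip: of_real_mult)
  \<comment> \<open>Equality of the orders lets one constant normalize both tables.\<close>
  have ct: "char_table G \<chi> a = c * \<chi> a" and ct': "char_table G' \<psi> b = c * \<psi> b" for \<chi> a \<psi> b
    using assms(5) by (simp_all add: char_table_def c_def n_def)
  show ?thesis
    unfolding mat_eq_on_def
  proof (intro ballI)
    fix a b assume a: "a \<in> carrier G" and b: "b \<in> carrier G'"
    have "U_matrix G G' \<pi>h a b =
      (\<Sum>t\<in>carrier G'. cnj (c * f (\<pi> t) a) *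
        mat_mult ?X' (perm_matrix \<pi>h) (char_table G') (f (\<pi> t)) b)"
      unfolding U_matrix_def mat_mult_def[of ?X] mat_adjoint_def ct
      by (subst sum.reindex_bij_betw[OF bfp, symmetric]) simp
    also have "\<dots> = (\<Sum>t\<in>carrier G'. cnj (c * f (\<pi> t) a) * (c * f' t b))"
    proof (intro sum.cong refl)
      fix t assume t: "t \<in> carrier G'"
      then have "f' t \<in> ?X'" using bf' by (rule_tac bij_betwE[THEN bspec])
      then show "cnj (c * f (\<pi> t) a) *
          mat_mult ?X' (perm_matrix \<pi>h) (char_table G') (f (\<pi> t)) b =
          cnj (c * f (\<pi> t) a) * (c * f' t b)"
        using mat_mult_perm_matrix[OF fin(2) inj_h, of "f' t" "char_table G'" b]
        by (simp add: ph[OF t] ct')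
    qed
    also have "\<dots> = 1 / of_nat n * (\<Sum>t\<in>carrier G'. cnj (f (\<pi> t) a) * f' t b)"
      unfolding sum_distrib_left cc[symmetric] by (simp add: cnj_c ac_simps)
    finally have U: "U_matrix G G' \<pi>h a b = \<dots>" .
    \<comment> \<open>The conjugate factor is put first and indexed by \<open>s\<close>. The two
      factors \<open>1 / of_nat n\<close> stay separate: the inner one is absorbed by
      \<open>D_matrix\<close>, the outer one becomes the normalization of the two tables.\<close>
    have "Q_matrix G G' \<pi>h a b = 1 / of_nat n * (1 / of_nat n *
      ((\<Sum>s\<in>carrier G'. f (\<pi> s) a * cnj (f' s b)) * (\<Sum>t\<in>carrier G'. cnj (f (\<pi> t) a) * f' t b)))"
      unfolding Q_matrix_def entrywise_mult_def mat_conj_def U by simp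
    also have "(\<Sum>s\<in>carrier G'. f (\<pi> s) a * cnj (f' s b)) * (\<Sum>t\<in>carrier G'. cnj (f (\<pi> t) a) * f' t b) =
      (\<Sum>s\<in>carrier G'. \<Sum>t\<in>carrier G'. cnj (f (inv\<^bsub>G\<^esub> \<pi> s \<otimes>\<^bsub>G\<^esub> \<pi> t) a) * f' (inv\<^bsub>G'\<^esub> s \<otimes>\<^bsub>G'\<^esub> t) b)"
      unfolding sum_product
    proof (intro sum.cong refl)
      fix s t assume "s \<in> carrier G'" "t \<in> carrier G'"
      then show "f (\<pi> s) a * cnj (f' s b) * (cnj (f (\<pi> t) a) * f' t b) =
          cnj (f (inv\<^bsub>G\<^esub> \<pi> s \<otimes>\<^bsub>G\<^esub> \<pi> t) a) * f' (inv\<^bsub>G'\<^esub> s \<otimes>\<^bsub>G'\<^esub> t) b"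
        using inv_iso_char_group_inv_mult[OF G.is_group assms(2,6) p_in p_in a, folded f_def]
          inv_iso_char_group_inv_mult[OF G'.is_group assms(4,7) _ _ b, folded f'_def]
        by simp
    qed
    \<comment> \<open>\<open>sum_D_matrix\<close> read backwards, with
      \<open>h x y = cnj (f x a) * f' y b\<close>.\<close>
    also have "1 / of_nat n * \<dots> =
      (\<Sum>x\<in>carrier G. \<Sum>y\<in>carrier G'. D_matrix G G' \<pi> x y * (cnj (f x a) * f' y b))"
      unfolding n_def
      by (rule sum_D_matrix[OF G.is_group assms(2) G'.is_group assms(4,5) p_sub, symmetric])
    also have "1 / of_nat n * \<dots> = (\<Sum>x\<in>carrier G. cnj (c * f x a) *
        (\<Sum>y\<in>carrier G'. D_matrix G G' \<pi> x y * (c * f' y b)))"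
      unfolding sum_distrib_left cc[symmetric] by (simp add: cnj_c ac_simps)
    also have "\<dots> = (\<Sum>x\<in>carrier G. cnj (c * f x a) *
        (\<Sum>y\<in>carrier G'. D_matrix G G' \<pi> x y *
          mat_mult ?X' (perm_matrix \<phi>') (char_table G') y b))"
    proof -
      have "mat_mult ?X' (perm_matrix \<phi>') (char_table G') y b = c * f' y b"
        if y: "y \<in> carrier G'" for y
      proof -
        have "f' y \<in> ?X'" using bf' y by (rule_tac bij_betwE[THEN bspec])
        then show ?thesis
          using mat_mult_perm_matrix[OF fin(2) bij_betw_imp_inj_on[OF bij'], of "f' y" "char_table G'" b]
          by (simp add: pf'[OF y] ct')
      qed
      then show ?thesis by simp
    qed
    \<comment> \<open>Row \<open>f x\<close> of the adjoint permutation matrix selects row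
      \<open>\<phi> (f x) = x\<close>; afterwards \<open>f\<close> turns the sum over
      \<open>G\<close> into one over characters.\<close>
    also have "\<dots> = (\<Sum>x\<in>carrier G. cnj (c * f x a) *
        mat_mult (carrier G) (mat_adjoint (perm_matrix \<phi>))
          (mat_mult (carrier G') (D_matrix G G' \<pi>)
            (mat_mult ?X' (perm_matrix \<phi>') (char_table G'))) (f x) b)"
      by (intro sum.cong refl)
        (simp add: mat_mult_adjoint_perm_matrix assms(2) pf mat_mult_def[of "carrier G'"])
    also have "\<dots> = mat_mult ?X (mat_adjoint (char_table G))
      (mat_mult (carrier G) (mat_adjoint (perm_matrix \<phi>))
        (mat_mult (carrier G') (D_matrix G G' \<pi>)
          (mat_mult ?X' (perm_matrix \<phi>') (char_table G')))) a b"
      unfolding mat_mult_def[of ?X] mat_adjoint_def[of "char_table G"] ct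
      by (subst sum.reindex_bij_betw[OF bf, symmetric]) simp
    finally show "Q_matrix G G' \<pi>h a b = \<dots>" .
  qed
qed

end
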